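(* Let $G,H$ be finite graphs with no isolated vertices, and let $\phi,\psi:G\to H$ be graph morphisms that are $\times$-homotopic. Then there is a natural isomorphism from the functor $\phi_*:\Pi(G)\to\Pi(H)$ to the functor $\psi_*:\Pi(G)\to\Pi(H)$.
   Context: A graph $G$ is undirected without multiple edges, loops allowed: a vertex set $V(G)$ with a symmetric adjacency relation $\sim$ (edges). A vertex is isolated if it is adjacent to no vertex (a looped vertex is adjacent to itself, hence not isolated). A graph morphism $f: G\to H$ is a map $V(G)\to V(H)$ with $v_1\sim v_2 \Rightarrow f(v_1)\sim f(v_2)$. The product $G\times H$ has vertices $V(G)\times V(H)$, with $(v_1,w_1)\sim(v_2,w_2)$ iff $v_1\sim v_2$ and $w_1\sim w_2$. $P_n$ is the graph on $\{0,\dots,n\}$ whose edges are $i\sim i+1$; $I_n^\ell$ is the graph on $\{0,\dots,n\}$ whose edges are $i\sim i$ and $i\sim i+1$. Morphisms $f,g:G\to H$ are $\times$-homotopic if for some $n$ there is a morphism $\Lambda:G\times I_n^\ell\to H$ with $\Lambda(\cdot,0)=f$ and $\Lambda(\cdot,n)=g$. A walk of length $n\ge0$ in $G$ from $v_0$ to $v_n$ is a morphism $P_n\to G$, written $(v_0v_1\dots v_n)$. Concatenation of $(x v_1\dots v_{n-1}y)$ with $(y w_1\dots w_{m-1}z)$ is $(x v_1\dots v_{n-1}y w_1\dots w_{m-1}z)$. If $v_i=v_{i+2}$ in a walk, the prune at $i$ is the walk obtained by deleting the entries $v_i,v_{i+1}$. Two walks $\alpha,\beta$ of length $n$ from $x$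 to $y$ are homotopic rel endpoints if there are $m\ge 0$ and a morphism $\Lambda:P_n\times I_m^\ell\to G$ with $\Lambda(\cdot,0)=\alpha$, $\Lambda(\cdot,m)=\beta$, and $\Lambda(0,j)=x$, $\Lambda(n,j)=y$ for all $j$. The fundamental groupoid $\Pi(G)$ has as objects the vertices of $G$; arrows from $v$ to $w$ are equivalence classes of walks from $v$ to $w$ under the equivalence relation generated by prunes and homotopy rel endpoints; composition is induced by concatenation. A morphism $\phi:G\to H$ induces the functor $\phi_*:\Pi(G)\to\Pi(H)$, $\phi_*(v)=\phi(v)$, $\phi_*[(v_0\dots v_n)]=[(\phi(v_0)\dots\phi(v_n))]$. *)

theory Defs
  imports "Graph_Theory.Graph_Theory"
begin

section \<open>Graphs\<close>

text \<open>
  A graph (undirected, no multiple edges, loops allowed) is a symmetric relation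
  \<^term>\<open>parcs G\<close> on a vertex set \<^term>\<open>pverts G\<close>; finite graphs are exactly the
  instances of the locale \<^locale>\<open>pair_pseudo_graph\<close>.
\<close>

text \<open>Maps between graphs are total functions on the vertex types; only their values on
  \<^term>\<open>pverts G\<close> matter.\<close>

definition graph_hom :: "'a pair_pre_digraph \<Rightarrow> 'b pair_pre_digraph \<Rightarrow> ('a \<Rightarrow> 'b) \<Rightarrow> bool" where
  "graph_hom G H f \<longleftrightarrow>
     (\<forall>v \<in> pverts G. f v \<in> pverts H) \<and>
     (\<forall>u v. (u, v) \<in> parcs G \<longrightarrow> (f u, f v) \<in> parcs H)"

text \<open>A vertex carrying a loop is adjacent to itself, so it is not isolated.\<close>

definition isolated_vertex :: "'a pair_pre_digraph \<Rightarrow> 'a \<Rightarrow> bool" where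
  "isolated_vertex G v \<longleftrightarrow> v \<in> pverts G \<and> (\<forall>w. (v, w) \<notin> parcs G)"

definition graph_prod ::
  "'a pair_pre_digraph \<Rightarrow> 'b pair_pre_digraph \<Rightarrow> ('a \<times> 'b) pair_pre_digraph" where
  "graph_prod G H =
     \<lparr> pverts = pverts G \<times> pverts H,
       parcs = {((v1, w1), (v2, w2)) | v1 w1 v2 w2. (v1, v2) \<in> parcs G \<and> (w1, w2) \<in> parcs H} \<rparr>"

definition path_graph :: "nat \<Rightarrow> nat pair_pre_digraph" where
  "path_graph n =
     \<lparr> pverts = {0..n},
       parcs = {(i, j). i \<le> n \<and> j \<le> n \<and> (j = Suc i \<or> i = Suc j)} \<rparr>"

definition looped_path_graph :: "nat \<Rightarrow> nat pair_pre_digraph" where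
  "looped_path_graph n =
     \<lparr> pverts = {0..n},
       parcs = {(i, j). i \<le> n \<and> j \<le> n \<and> (i = j \<or> j = Suc i \<or> i = Suc j)} \<rparr>"

lemma pair_pseudo_graph_path_graph: "pair_pseudo_graph (path_graph n)"
proof -
  have "parcs (path_graph n) \<subseteq> {0..n} \<times> {0..n}"
    by (auto simp: path_graph_def)
  then have "finite (parcs (path_graph n))"
    by (rule finite_subset) simp
  then show ?thesis
    by unfold_locales (auto simp: path_graph_def symmetric_def sym_def)
qed

lemma pair_pseudo_graph_looped_path_graph: "pair_pseudo_graph (looped_path_graph n)"
proof -
  have "parcs (looped_path_graph n) \<subseteq> {0..n} \<times> {0..n}"
    by (auto simp: looped_path_graph_def)
  then have "finite (parcs (looped_path_graph n))"
    by (rule finite_subset) simp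
  then show ?thesis
    by unfold_locales (auto simp: looped_path_graph_def symmetric_def sym_def)
qed

definition times_homotopic ::
  "'a pair_pre_digraph \<Rightarrow> 'b pair_pre_digraph \<Rightarrow> ('a \<Rightarrow> 'b) \<Rightarrow> ('a \<Rightarrow> 'b) \<Rightarrow> bool" where
  "times_homotopic G H f g \<longleftrightarrow>
     (\<exists>n \<Lambda>. graph_hom (graph_prod G (looped_path_graph n)) H \<Lambda> \<and>
        (\<forall>v \<in> pverts G. \<Lambda> (v, 0) = f v) \<and>
        (\<forall>v \<in> pverts G. \<Lambda> (v, n) = g v))"

section \<open>Walks\<close>

text \<open>A walk of length \<open>n\<close> is represented by the list of its \<open>n + 1\<close> vertices.\<close>

definition walks :: "'a pair_pre_digraph \<Rightarrow> 'a \<Rightarrow> 'a \<Rightarrow> 'a list set" where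
  "walks G v w =
     {\<alpha>. \<alpha> \<noteq> [] \<and> graph_hom (path_graph (length \<alpha> - 1)) G (\<lambda>i. \<alpha> ! i) \<and>
         hd \<alpha> = v \<and> last \<alpha> = w}"

text \<open>Meaningful only when the last vertex of the first walk is the first vertex of the second.\<close>

definition walk_concat :: "'a list \<Rightarrow> 'a list \<Rightarrow> 'a list" where
  "walk_concat \<alpha> \<beta> = \<alpha> @ tl \<beta>"

definition prune :: "nat \<Rightarrow> 'a list \<Rightarrow> 'a list" where
  "prune i \<alpha> = take i \<alpha> @ drop (i + 2) \<alpha>"

definition homotopic_rel_endpoints ::
  "'a pair_pre_digraph \<Rightarrow> 'a list \<Rightarrow> 'a list \<Rightarrow> bool" where
  "homotopic_rel_endpoints G \<alpha> \<beta> \<longleftrightarrow>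
     (\<exists>x y n. \<alpha> \<in> walks G x y \<and> \<beta> \<in> walks G x y \<and> length \<alpha> = Suc n \<and> length \<beta> = Suc n \<and>
        (\<exists>m \<Lambda>. graph_hom (graph_prod (path_graph n) (looped_path_graph m)) G \<Lambda> \<and>
           (\<forall>i \<le> n. \<Lambda> (i, 0) = \<alpha> ! i) \<and> (\<forall>i \<le> n. \<Lambda> (i, m) = \<beta> ! i) \<and>
           (\<forall>j \<le> m. \<Lambda> (0, j) = x \<and> \<Lambda> (n, j) = y)))"

inductive walk_step :: "'a pair_pre_digraph \<Rightarrow> 'a list \<Rightarrow> 'a list \<Rightarrow> bool" for G where
  prune: "\<alpha> \<in> walks G v w \<Longrightarrow> i + 2 < length \<alpha> \<Longrightarrow> \<alpha> ! i = \<alpha> ! (i + 2) \<Longrightarrow>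
    walk_step G \<alpha> (prune i \<alpha>)"
| homotopy: "homotopic_rel_endpoints G \<alpha> \<beta> \<Longrightarrow> walk_step G \<alpha> \<beta>"

text \<open>Both kinds of step relate walks with the same endpoints. On lists that are not walks
  the generated equivalence is just equality.\<close>

definition walk_equiv :: "'a pair_pre_digraph \<Rightarrow> 'a list rel" where
  "walk_equiv G = {(\<alpha>, \<beta>). equivclp (walk_step G) \<alpha> \<beta>}"

section \<open>Categories, functors and natural isomorphisms\<close>

record ('o, 'm) precategory =
  Obj :: "'o set"
  Hom :: "'o \<Rightarrow> 'o \<Rightarrow> 'm set"
  Ident :: "'o \<Rightarrow> 'm"
  Comp :: "'m \<Rightarrow> 'm \<Rightarrow> 'm"

text \<open>\<^term>\<open>Comp C g f\<close> is \<open>g\<close> after \<open>f\<close>.\<close>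

locale category =
  fixes C :: "('o, 'm) precategory"
  assumes Ident_in_Hom: "x \<in> Obj C \<Longrightarrow> Ident C x \<in> Hom C x x"
    and Comp_in_Hom: "\<lbrakk> x \<in> Obj C; y \<in> Obj C; z \<in> Obj C; f \<in> Hom C x y; g \<in> Hom C y z \<rbrakk>
      \<Longrightarrow> Comp C g f \<in> Hom C x z"
    and Comp_Ident_right: "\<lbrakk> x \<in> Obj C; y \<in> Obj C; f \<in> Hom C x y \<rbrakk> \<Longrightarrow> Comp C f (Ident C x) = f"
    and Comp_Ident_left: "\<lbrakk> x \<in> Obj C; y \<in> Obj C; f \<in> Hom C x y \<rbrakk> \<Longrightarrow> Comp C (Ident C y) f = f"
    and Comp_assoc: "\<lbrakk> w \<in> Obj C; x \<in> Obj C; y \<in> Obj C; z \<in> Obj C;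
        f \<in> Hom C w x; g \<in> Hom C x y; h \<in> Hom C y z \<rbrakk>
      \<Longrightarrow> Comp C h (Comp C g f) = Comp C (Comp C h g) f"

definition iso_arrow :: "('o, 'm) precategory \<Rightarrow> 'o \<Rightarrow> 'o \<Rightarrow> 'm \<Rightarrow> bool" where
  "iso_arrow C x y f \<longleftrightarrow> f \<in> Hom C x y \<and>
     (\<exists>g \<in> Hom C y x. Comp C g f = Ident C x \<and> Comp C f g = Ident C y)"

record ('o1, 'm1, 'o2, 'm2) functor_data =
  obj_map :: "'o1 \<Rightarrow> 'o2"
  arr_map :: "'m1 \<Rightarrow> 'm2"

locale cat_functor = C: category C + D: category D
  for C :: "('o1, 'm1) precategory" and D :: "('o2, 'm2) precategory" +
  fixes F :: "('o1, 'm1, 'o2, 'm2) functor_data"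
  assumes obj_map_in_Obj: "x \<in> Obj C \<Longrightarrow> obj_map F x \<in> Obj D"
    and arr_map_in_Hom: "\<lbrakk> x \<in> Obj C; y \<in> Obj C; f \<in> Hom C x y \<rbrakk>
      \<Longrightarrow> arr_map F f \<in> Hom D (obj_map F x) (obj_map F y)"
    and arr_map_Ident: "x \<in> Obj C \<Longrightarrow> arr_map F (Ident C x) = Ident D (obj_map F x)"
    and arr_map_Comp: "\<lbrakk> x \<in> Obj C; y \<in> Obj C; z \<in> Obj C; f \<in> Hom C x y; g \<in> Hom C y z \<rbrakk>
      \<Longrightarrow> arr_map F (Comp C g f) = Comp D (arr_map F g) (arr_map F f)"

locale natural_transformation = F: cat_functor C D F + F': cat_functor C D F'
  for C :: "('o1, 'm1) precategory" and D :: "('o2, 'm2) precategory"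
    and F F' :: "('o1, 'm1, 'o2, 'm2) functor_data" +
  fixes \<eta> :: "'o1 \<Rightarrow> 'm2"
  assumes component_in_Hom: "x \<in> Obj C \<Longrightarrow> \<eta> x \<in> Hom D (obj_map F x) (obj_map F' x)"
    and naturality: "\<lbrakk> x \<in> Obj C; y \<in> Obj C; f \<in> Hom C x y \<rbrakk>
      \<Longrightarrow> Comp D (arr_map F' f) (\<eta> x) = Comp D (\<eta> y) (arr_map F f)"

locale natural_isomorphism = natural_transformation +
  assumes component_iso: "x \<in> Obj C \<Longrightarrow> iso_arrow D (obj_map F x) (obj_map F' x) (\<eta> x)"

section \<open>The fundamental groupoid\<close>

text \<open>
  Operations on equivalence classes are defined as the union of the classes obtained from all
  representatives. As composition is written in the order \<open>g\<close> after \<open>f\<close>, \<^term>\<open>Comp\<close> of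
  \<open>d\<close> and \<open>c\<close> is the class of a walk in \<open>c\<close> followed by a walk in \<open>d\<close>.
\<close>

definition fundamental_groupoid :: "'a pair_pre_digraph \<Rightarrow> ('a, 'a list set) precategory" where
  "fundamental_groupoid G =
     \<lparr> Obj = pverts G,
       Hom = (\<lambda>v w. walks G v w // walk_equiv G),
       Ident = (\<lambda>v. walk_equiv G `` {[v]}),
       Comp = (\<lambda>d c. \<Union>\<alpha> \<in> c. \<Union>\<beta> \<in> d. walk_equiv G `` {walk_concat \<alpha> \<beta>}) \<rparr>"

definition induced_functor ::
  "'b pair_pre_digraph \<Rightarrow> ('a \<Rightarrow> 'b) \<Rightarrow> ('a, 'a list set, 'b, 'b list set) functor_data" where
  "induced_functor H \<phi> =
     \<lparr> obj_map = \<phi>,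
       arr_map = (\<lambda>c. \<Union>\<alpha> \<in> c. walk_equiv H `` {map \<phi> \<alpha>}) \<rparr>"

end

theory Submission
  imports Defs
begin

text \<open>
  Restricting a \<open>\<times>\<close>-homotopy \<open>\<Lambda>\<close> to consecutive levels reduces the claim to morphisms \<open>f\<close>, \<open>g\<close>
  with \<open>f v \<sim> g w\<close> whenever \<open>v \<sim> w\<close>. There the component at \<open>v\<close> is the class of the walk
  \<open>(f v, f u, g v)\<close> for any neighbour \<open>u\<close> of \<open>v\<close>; naturality along an edge holds because two walks
  that differ in one inner vertex are homotopic. Components of successive levels are concatenated,
  and reversed walks provide inverses.
\<close>

section \<open>Walks as lists of successively adjacent vertices\<close>

lemma parcs_sym:
  assumes "pair_pseudo_graph G" "(u, v) \<in> parcs G"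
  shows "(v, u) \<in> parcs G"
proof -
  interpret pair_pseudo_graph G by fact
  show ?thesis
    using assms(2) sym_arcs by (auto simp: symmetric_def sym_def)
qed

lemma parcs_in_pverts:
  assumes "pair_pseudo_graph G" "(u, v) \<in> parcs G"
  shows "u \<in> pverts G" "v \<in> pverts G"
proof -
  interpret pair_pseudo_graph G by fact
  show "u \<in> pverts G" "v \<in> pverts G"
    using assms(2) in_arcsD1 in_arcsD2 by auto
qed

text \<open>A morphism from a path is determined by its values on consecutive indices. The path has
  both orientations of each edge, and the backward ones are preserved because \<open>parcs G\<close>
  is symmetric. This list form lets the facts about append, reverse and map from the list library
  apply to walks.\<close>

lemma walks_iff:
  assumes G: "pair_pseudo_graph G"
  shows "\<alpha> \<in> walks G v w \<longleftrightarrow> \<alpha> \<noteq> [] \<and> set \<alpha> \<subseteq> pverts G \<and>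
    successively (\<lambda>a b. (a, b) \<in> parcs G) \<alpha> \<and> hd \<alpha> = v \<and> last \<alpha> = w"
proof -
  have "graph_hom (path_graph (length \<alpha> - 1)) G ((!) \<alpha>) \<longleftrightarrow>
      set \<alpha> \<subseteq> pverts G \<and> successively (\<lambda>a b. (a, b) \<in> parcs G) \<alpha>" if "\<alpha> \<noteq> []"
  proof -
    have "{0..length \<alpha> - 1} = {0..<length \<alpha>}"
      using that by (simp flip: atLeastLessThanSuc_atLeastAtMost)
    then have "set \<alpha> = (!) \<alpha> ` {0..length \<alpha> - 1}"
      using nth_image[of "length \<alpha>" \<alpha>] by simp
    then have 1: "(\<forall>i\<in>{0..length \<alpha> - 1}. \<alpha> ! i \<in> pverts G) \<longleftrightarrow> set \<alpha> \<subseteq> pverts G"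
      by auto
    have 2: "(\<forall>i j. i \<le> length \<alpha> - 1 \<and> j \<le> length \<alpha> - 1 \<and> (j = Suc i \<or> i = Suc j) \<longrightarrow>
        (\<alpha> ! i, \<alpha> ! j) \<in> parcs G) \<longleftrightarrow> (\<forall>i. Suc i < length \<alpha> \<longrightarrow> (\<alpha> ! i, \<alpha> ! Suc i) \<in> parcs G)"
      (is "?L \<longleftrightarrow> ?R")
    proof
      assume L: ?L
      show ?R by (auto intro!: L[rule_format])
    next
      assume R: ?R
      show ?L
      proof (intro allI impI)
        fix i j assume "i \<le> length \<alpha> - 1 \<and> j \<le> length \<alpha> - 1 \<and> (j = Suc i \<or> i = Suc j)"
        with that have "Suc i < length \<alpha> \<and> j = Suc i \<or> Suc j < length \<alpha> \<and> i = Suc j"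
          by (cases \<alpha>) auto
        then show "(\<alpha> ! i, \<alpha> ! j) \<in> parcs G"
          using R parcs_sym[OF G] by auto
      qed
    qed
    show ?thesis
      unfolding graph_hom_def path_graph_def successively_conv_nth using 1 2 by simp
  qed
  then show ?thesis
    by (auto simp: walks_def)
qed

lemma walk_singleton: "v \<in> pverts G \<Longrightarrow> [v] \<in> walks G v v"
  by (auto simp: walks_def graph_hom_def path_graph_def)

lemma walk_edge: "pair_pseudo_graph G \<Longrightarrow> (u, v) \<in> parcs G \<Longrightarrow> [u, v] \<in> walks G u v"
  by (auto simp: walks_iff dest: parcs_in_pverts)

lemma walk_concat_in_walks:
  assumes G: "pair_pseudo_graph G" and "\<alpha> \<in> walks G x y" "\<beta> \<in> walks G y z"
  shows "walk_concat \<alpha> \<beta> \<in> walks G x z"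
proof (cases \<beta>)
  case (Cons b \<beta>')
  then show ?thesis
    using assms(2,3) by (cases \<beta>')
      (auto simp: walks_iff[OF G] walk_concat_def successively_append_iff)
qed (use assms in \<open>auto simp: walks_iff[OF G]\<close>)

lemma walk_rev:
  assumes G: "pair_pseudo_graph G" and "\<alpha> \<in> walks G x y"
  shows "rev \<alpha> \<in> walks G y x"
proof -
  have "successively (\<lambda>a b. (b, a) \<in> parcs G) \<alpha>"
    using assms(2) parcs_sym[OF G] by (auto simp: walks_iff[OF G] elim: successively_mono)
  then show ?thesis
    using assms(2) by (auto simp: walks_iff[OF G] successively_rev hd_rev last_rev)
qed

lemma walk_map:
  assumes "pair_pseudo_graph G" "pair_pseudo_graph H" "graph_hom G H f" "\<alpha> \<in> walks G x y"
  shows "map f \<alpha> \<in> walks H (f x) (f y)"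
  using assms by (auto simp: walks_iff graph_hom_def successively_map hd_map last_map
      elim!: successively_mono)

section \<open>Elementary steps and the equivalence they generate\<close>

text \<open>The second condition says that \<open>\<alpha>\<close> and \<open>\<beta>\<close> are the two rows of a morphism
  from the product of a path with \<open>I\<^sub>1\<close>, the looped path of length one.\<close>

definition cross_adjacent :: "'a pair_pre_digraph \<Rightarrow> 'a list \<Rightarrow> 'a list \<Rightarrow> bool" where
  "cross_adjacent G \<alpha> \<beta> \<longleftrightarrow> length \<alpha> = length \<beta> \<and>
     (\<forall>i. Suc i < length \<alpha> \<longrightarrow> (\<alpha> ! i, \<beta> ! Suc i) \<in> parcs G \<and> (\<beta> ! i, \<alpha> ! Suc i) \<in> parcs G)"

text \<open>These are convenient generators for the relation \<open>walk_equiv\<close>. A prune is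
  displayed as the removal of a spur inside an append, so that adding a context or applying
  \<open>map\<close> keeps its shape. A homotopy is cut into single levels, so that only two rows
  have to be compared at a time.\<close>

inductive elementary_step :: "'a pair_pre_digraph \<Rightarrow> 'a list \<Rightarrow> 'a list \<Rightarrow> bool" for G where
  spur: "xs @ [a, b, a] @ ys \<in> walks G v w \<Longrightarrow>
    elementary_step G (xs @ [a, b, a] @ ys) (xs @ [a] @ ys)"
| cross: "\<alpha> \<in> walks G v w \<Longrightarrow> \<beta> \<in> walks G v w \<Longrightarrow> cross_adjacent G \<alpha> \<beta> \<Longrightarrow>
    elementary_step G \<alpha> \<beta>"

lemma remove_spur_in_walks:
  assumes "pair_pseudo_graph G" "xs @ [a, b, a] @ ys \<in> walks G v w"
  shows "xs @ [a] @ ys \<in> walks G v w"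
  using assms by (cases xs) (auto simp: walks_iff successively_append_iff successively_Cons hd_append)

lemma elementary_step_walks:
  assumes "pair_pseudo_graph G" "elementary_step G \<alpha> \<beta>"
  obtains v w where "\<alpha> \<in> walks G v w" "\<beta> \<in> walks G v w"
  using assms(2) by cases (blast intro: that remove_spur_in_walks[OF assms(1)])+

lemma spur_imp_walk_step:
  assumes "xs @ [a, b, a] @ ys \<in> walks G v w"
  shows "walk_step G (xs @ [a, b, a] @ ys) (xs @ [a] @ ys)"
proof -
  have "prune (length xs) (xs @ [a, b, a] @ ys) = xs @ [a] @ ys"
    by (simp add: prune_def)
  then show ?thesis
    using walk_step.prune[OF assms, of "length xs"] by (simp add: nth_append)
qed

lemma prune_imp_elementary_step:
  assumes "\<alpha> \<in> walks G v w" "i + 2 < length \<alpha>" "\<alpha> ! i = \<alpha> ! (i + 2)"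
  shows "elementary_step G \<alpha> (prune i \<alpha>)"
proof -
  let ?a = "\<alpha> ! i" and ?b = "\<alpha> ! Suc i"
  \<comment> \<open>Pruning deletes the first occurrence of \<open>?a\<close> together with
    \<open>?b\<close>. The second occurrence of \<open>?a\<close> remains as the head of the dropped
    part, which gives the shape required by \<open>spur\<close>.\<close>
  have d: "drop (i + 2) \<alpha> = ?a # drop (i + 3) \<alpha>"
    using assms(2,3) Cons_nth_drop_Suc[of "i + 2" \<alpha>] by (simp add: numeral_3_eq_3)
  moreover have "drop i \<alpha> = ?a # ?b # drop (i + 2) \<alpha>"
    using assms(2) Cons_nth_drop_Suc[of i \<alpha>] Cons_nth_drop_Suc[of "Suc i" \<alpha>] by simp
  ultimately have "\<alpha> = take i \<alpha> @ [?a, ?b, ?a] @ drop (i + 3) \<alpha>"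
    using append_take_drop_id[of i \<alpha>] by simp
  moreover have "prune i \<alpha> = take i \<alpha> @ [?a] @ drop (i + 3) \<alpha>"
    using d by (simp add: prune_def)
  ultimately show ?thesis
    using elementary_step.spur assms(1) by metis
qed

lemma cross_imp_homotopic:
  assumes G: "pair_pseudo_graph G"
    and \<alpha>: "\<alpha> \<in> walks G v w" and \<beta>: "\<beta> \<in> walks G v w" and c: "cross_adjacent G \<alpha> \<beta>"
  shows "homotopic_rel_endpoints G \<alpha> \<beta>"
proof -
  define n where "n = length \<alpha> - 1"
  \<comment> \<open>Only the levels 0 and 1 matter. Sending every positive level to
    \<open>\<beta>\<close> makes the adjacencies \<open>up\<close> and \<open>down\<close> hold for
    arbitrary levels, without bounds on \<open>j\<close> and \<open>k\<close>.\<close>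
  define \<Lambda> where "\<Lambda> = (\<lambda>(i, j::nat). if j = 0 then \<alpha> ! i else \<beta> ! i)"
  have len: "length \<alpha> = Suc n" "length \<beta> = Suc n"
    using \<alpha> \<beta> c by (simp_all add: n_def walks_iff[OF G] cross_adjacent_def)
  have A: "(\<alpha> ! i, \<alpha> ! Suc i) \<in> parcs G" "(\<beta> ! i, \<beta> ! Suc i) \<in> parcs G"
    "(\<alpha> ! i, \<beta> ! Suc i) \<in> parcs G" "(\<beta> ! i, \<alpha> ! Suc i) \<in> parcs G" if "i < n" for i
    using \<alpha> \<beta> c that len
    by (auto simp: walks_iff[OF G] successively_conv_nth cross_adjacent_def)
  have up: "(\<Lambda> (i, j), \<Lambda> (Suc i, k)) \<in> parcs G" if "i < n" for i j k
    using A[OF that] by (simp add: \<Lambda>_def)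
  have down: "(\<Lambda> (Suc i, j), \<Lambda> (i, k)) \<in> parcs G" if "i < n" for i j k
    using up[OF that] by (rule parcs_sym[OF G])
  have "\<Lambda> (i, j) \<in> pverts G" if "i \<le> n" for i j
    using that len \<alpha> \<beta> by (simp add: walks_iff[OF G] subset_iff \<Lambda>_def)
  then have "graph_hom (graph_prod (path_graph n) (looped_path_graph 1)) G \<Lambda>"
    using up down
    by (auto simp: graph_hom_def graph_prod_def path_graph_def looped_path_graph_def Suc_le_eq)
  moreover have "\<alpha> ! 0 = v" "\<beta> ! 0 = v" "\<alpha> ! n = w" "\<beta> ! n = w"
    using \<alpha> \<beta> len by (auto simp: walks_iff[OF G] hd_conv_nth last_conv_nth)
  ultimately show ?thesis
    unfolding homotopic_rel_endpoints_def using \<alpha> \<beta> len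
    by (intro exI[of _ v] exI[of _ w] exI[of _ n] conjI exI[of _ 1] exI[of _ \<Lambda>])
      (auto simp: \<Lambda>_def)
qed

text \<open>Each level of the homotopy is a walk with the fixed endpoints, and two consecutive
  levels are cross adjacent. Thus \<open>\<alpha>\<close> reaches \<open>\<beta>\<close> by one
  \<open>cross\<close> step per level.\<close>

lemma homotopic_imp_elementary_steps:
  assumes G: "pair_pseudo_graph G" and "homotopic_rel_endpoints G \<alpha> \<beta>"
  shows "(elementary_step G)\<^sup>*\<^sup>* \<alpha> \<beta>"
proof -
  obtain x y n m \<Lambda> where \<alpha>: "length \<alpha> = Suc n" and \<beta>: "length \<beta> = Suc n"
    and hom: "graph_hom (graph_prod (path_graph n) (looped_path_graph m)) G \<Lambda>"
    and \<Lambda>: "\<And>i. i \<le> n \<Longrightarrow> \<Lambda> (i, 0) = \<alpha> ! i" "\<And>i. i \<le> n \<Longrightarrow> \<Lambda> (i, m) = \<beta> ! i"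
      "\<And>j. j \<le> m \<Longrightarrow> \<Lambda> (0, j) = x" "\<And>j. j \<le> m \<Longrightarrow> \<Lambda> (n, j) = y"
    using assms(2) unfolding homotopic_rel_endpoints_def by blast
  define row where "row j = map (\<lambda>i. \<Lambda> (i, j)) [0..<Suc n]" for j
  have len: "length (row j) = Suc n" for j
    by (simp add: row_def)
  have nth: "row j ! i = \<Lambda> (i, j)" if "i \<le> n" for i j
    using that by (simp add: row_def del: upt_Suc)
  have arc: "(\<Lambda> (i, j), \<Lambda> (Suc i, k)) \<in> parcs G"
    if "i < n" "j \<le> m" "k \<le> m" "j = k \<or> k = Suc j \<or> j = Suc k" for i j k
    using hom that
    by (auto simp: graph_hom_def graph_prod_def path_graph_def looped_path_graph_def)
  have vert: "\<Lambda> (i, j) \<in> pverts G" if "i \<le> n" "j \<le> m" for i j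
    using hom that
    by (auto simp: graph_hom_def graph_prod_def path_graph_def looped_path_graph_def)
  \<comment> \<open>The loop at \<open>j\<close> in the looped path makes a single row a walk: this
    is \<open>arc\<close> with both levels equal to \<open>j\<close>.\<close>
  have walk: "row j \<in> walks G x y" if "j \<le> m" for j
  proof -
    have "hd (row j) = x" "last (row j) = y"
      using \<Lambda> that nth[of 0 j] nth[of n j] len[of j]
      by (auto simp: hd_conv_nth last_conv_nth simp flip: length_greater_0_conv)
    moreover have "set (row j) \<subseteq> pverts G"
      using vert that by (auto simp: row_def)
    moreover have "successively (\<lambda>a b. (a, b) \<in> parcs G) (row j)"
      using arc that by (auto simp: successively_conv_nth len nth)
    ultimately show ?thesis
      using len[of j] by (auto simp: walks_iff[OF G])
  qed
  have "(elementary_step G)\<^sup>*\<^sup>* (row 0) (row k)" if "k \<le> m" for k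
    using that
  proof (induction k)
    case (Suc k)
    have "cross_adjacent G (row k) (row (Suc k))"
      using arc Suc.prems by (auto simp: cross_adjacent_def len nth)
    then have "elementary_step G (row k) (row (Suc k))"
      using walk Suc.prems by (intro elementary_step.cross) auto
    then show ?case
      using Suc by (auto intro: rtranclp.rtrancl_into_rtrancl)
  qed simp
  moreover have "row 0 = \<alpha>" "row m = \<beta>"
    using \<alpha> \<beta> \<Lambda> nth len by (auto intro!: nth_equalityI)
  ultimately show ?thesis
    by (metis order_refl)
qed

text \<open>With \<open>f\<close> the identity this compares the equivalences generated by two
  relations; with \<open>f\<close> a \<open>map\<close> it transports an equivalence along a graph
  morphism.\<close>

lemma equivclp_map:
  assumes "\<And>a b. r a b \<Longrightarrow> equivclp s (f a) (f b)" "equivclp r a b"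
  shows "equivclp s (f a) (f b)"
  using assms(2)
proof (induction rule: equivclp_induct)
  case (step y z)
  have "equivclp s (f y) (f z)"
    using step.hyps(2) by (auto dest: assms(1) equivclp_sym)
  with step.IH show ?case
    by (rule equivclp_trans)
qed simp

lemma walk_equiv_iff:
  assumes G: "pair_pseudo_graph G"
  shows "(\<alpha>, \<beta>) \<in> walk_equiv G \<longleftrightarrow> equivclp (elementary_step G) \<alpha> \<beta>"
proof -
  have 1: "equivclp (elementary_step G) a b" if "walk_step G a b" for a b
    using that
  proof cases
    case (prune v w i)
    then show ?thesis
      using prune_imp_elementary_step[OF prune(2-)] by (simp add: r_into_equivclp)
  next
    case homotopy
    then show ?thesis
      by (intro predicate2D[OF rtranlcp_le_equivclp] homotopic_imp_elementary_steps[OF G])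
  qed
  have 2: "equivclp (walk_step G) a b" if "elementary_step G a b" for a b
    using that
  proof cases
    case (spur xs c d ys v w)
    then show ?thesis
      using spur_imp_walk_step[OF spur(3)] by (simp add: r_into_equivclp)
  next
    case cross
    then show ?thesis
      by (intro r_into_equivclp walk_step.homotopy cross_imp_homotopic[OF G])
  qed
  show ?thesis
    using equivclp_map[where f = "\<lambda>x. x", OF 1] equivclp_map[where f = "\<lambda>x. x", OF 2]
    by (auto simp: walk_equiv_def)
qed

lemma equiv_walk_equiv: "equiv UNIV (walk_equiv G)"
  unfolding walk_equiv_def equivp_equiv by simp

lemma walk_equiv_refl [simp]: "(\<alpha>, \<alpha>) \<in> walk_equiv G"
  by (simp add: walk_equiv_def)

lemma walk_equiv_sym: "(\<alpha>, \<beta>) \<in> walk_equiv G \<Longrightarrow> (\<beta>, \<alpha>) \<in> walk_equiv G"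
  by (simp add: walk_equiv_def equivclp_sym)

lemma walk_equiv_trans [trans]:
  "(\<alpha>, \<beta>) \<in> walk_equiv G \<Longrightarrow> (\<beta>, \<gamma>) \<in> walk_equiv G \<Longrightarrow> (\<alpha>, \<gamma>) \<in> walk_equiv G"
  unfolding walk_equiv_def by (blast intro: equivclp_trans)

lemma elementary_step_imp_walk_equiv:
  "pair_pseudo_graph G \<Longrightarrow> elementary_step G \<alpha> \<beta> \<Longrightarrow> (\<alpha>, \<beta>) \<in> walk_equiv G"
  by (simp add: walk_equiv_iff r_into_equivclp)

text \<open>A step may be used in either direction, and \<open>elementary_step_walks\<close> places
  both of its ends in one common set of walks. As a list determines its endpoints, this is the set
  for \<open>x\<close> and \<open>y\<close>.\<close>

lemma walk_equiv_in_walks: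
  assumes G: "pair_pseudo_graph G" and "(\<alpha>, \<beta>) \<in> walk_equiv G" and "\<alpha> \<in> walks G x y"
  shows "\<beta> \<in> walks G x y"
  using assms(2) unfolding walk_equiv_iff[OF G]
proof (induction rule: equivclp_induct)
  case (step \<beta> \<gamma>)
  then obtain v w where "\<beta> \<in> walks G v w" "\<gamma> \<in> walks G v w"
    using elementary_step_walks[OF G] by metis
  then show ?case
    using step.IH by (auto simp: walks_iff[OF G])
qed fact

section \<open>Compatibility with contexts, concatenation and morphisms\<close>

lemma walk_replace_middle:
  assumes G: "pair_pseudo_graph G"
    and "\<alpha> \<in> walks G x y" "\<beta> \<in> walks G x y" "xs @ \<alpha> @ ys \<in> walks G v w"
  shows "xs @ \<beta> @ ys \<in> walks G v w"
  using assms(2-) by (auto simp: walks_iff[OF G] successively_append_iff hd_append last_append)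

text \<open>A spur remains a spur inside a longer walk. For cross adjacent segments, the two long
  walks agree outside the segment and at its two ends, so the only new mixed adjacencies are those
  already known inside the segment.\<close>

lemma elementary_step_context:
  assumes G: "pair_pseudo_graph G"
    and step: "elementary_step G \<alpha> \<beta>" and w: "xs @ \<alpha> @ ys \<in> walks G v w"
  shows "elementary_step G (xs @ \<alpha> @ ys) (xs @ \<beta> @ ys)"
  using step
proof cases
  case (spur zs a b zs' x y)
  then show ?thesis
    using elementary_step.spur[of "xs @ zs" a b "zs' @ ys" G v w] w by simp
next
  case (cross x y)
  have "length \<alpha> = length \<beta>" "\<alpha> \<noteq> []" "\<beta> \<noteq> []"
    "hd \<alpha> = hd \<beta>" "last \<alpha> = last \<beta>"
    using cross by (auto simp: walks_iff[OF G] cross_adjacent_def)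
  note len = this
  let ?A = "xs @ \<alpha> @ ys" and ?B = "xs @ \<beta> @ ys"
  have B: "?B \<in> walks G v w"
    using walk_replace_middle[OF G cross(1,2) w] .
  have arcs: "(?A ! i, ?A ! Suc i) \<in> parcs G" "(?B ! i, ?B ! Suc i) \<in> parcs G"
    if "Suc i < length ?A" for i
    using w B that len(1) by (auto simp: walks_iff[OF G] successively_conv_nth)
  \<comment> \<open>The bounds include the first and the last position of the segment, where the
    walks agree because the segments have equal endpoints. This covers the edges that join the
    segment to \<open>xs\<close> and \<open>ys\<close>.\<close>
  have outer: "?A ! i = ?B ! i" if "i \<le> length xs \<or> length xs + length \<alpha> \<le> Suc i" for i
  proof (cases "i < length xs \<or> length xs + length \<alpha> \<le> i")
    case True
    then show ?thesis
      using len by (auto simp: nth_append)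
  next
    case False
    then have "i = length xs \<or> i = length xs + length \<alpha> - 1"
      using that by auto
    then show ?thesis
      using len by (auto simp: nth_append hd_conv_nth last_conv_nth)
  qed
  have "(?A ! i, ?B ! Suc i) \<in> parcs G \<and> (?B ! i, ?A ! Suc i) \<in> parcs G"
    if i: "Suc i < length ?A" for i
  proof -
    \<comment> \<open>In the first two cases the walks agree at both \<open>i\<close> and
      \<open>Suc i\<close>, so a mixed adjacency is an adjacency within one walk. In the third case
      both positions lie in the segment.\<close>
    consider "i \<le> length xs \<and> Suc i \<le> length xs" | "length xs + length \<alpha> \<le> Suc i"
      | "length xs \<le> i" "Suc i < length xs + length \<alpha>"
      by linarith
    then show ?thesis
    proof cases
      case 1
      then show ?thesis using arcs[OF i] outer[of i] outer[of "Suc i"] by simp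
    next
      case 2
      then show ?thesis using arcs[OF i] outer[of i] outer[of "Suc i"] by simp
    next
      case 3
      have "Suc (i - length xs) < length \<alpha>"
        using 3 by linarith
      then have "(\<alpha> ! (i - length xs), \<beta> ! Suc (i - length xs)) \<in> parcs G"
        "(\<beta> ! (i - length xs), \<alpha> ! Suc (i - length xs)) \<in> parcs G"
        using cross(3) by (auto simp: cross_adjacent_def)
      then show ?thesis
        using 3 len(1) by (auto simp: nth_append Suc_diff_le)
    qed
  qed
  then have "cross_adjacent G ?A ?B"
    using len(1) by (simp add: cross_adjacent_def)
  then show ?thesis
    using w B by (rule elementary_step.cross[rotated 2])
qed

lemma walk_equiv_context:
  assumes G: "pair_pseudo_graph G"
    and "(\<alpha>, \<beta>) \<in> walk_equiv G" and "xs @ \<alpha> @ ys \<in> walks G v w"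
  shows "(xs @ \<alpha> @ ys, xs @ \<beta> @ ys) \<in> walk_equiv G"
proof -
  \<comment> \<open>The induction also carries that the extended list is a walk, since each further
    step needs this to be placed in the context.\<close>
  have "xs @ \<beta> @ ys \<in> walks G v w \<and> (xs @ \<alpha> @ ys, xs @ \<beta> @ ys) \<in> walk_equiv G"
    using assms(2) unfolding walk_equiv_iff[OF G, of \<alpha> \<beta>]
  proof (induction rule: equivclp_induct)
    case (step \<beta> \<gamma>)
    then obtain x y where "\<beta> \<in> walks G x y" "\<gamma> \<in> walks G x y"
      using elementary_step_walks[OF G] by metis
    then have \<gamma>: "xs @ \<gamma> @ ys \<in> walks G v w"
      using walk_replace_middle[OF G] step.IH by blast
    have "(xs @ \<beta> @ ys, xs @ \<gamma> @ ys) \<in> walk_equiv G"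
      using step elementary_step_context[OF G] \<gamma> elementary_step_imp_walk_equiv[OF G]
        walk_equiv_sym by meson
    with \<gamma> step.IH show ?case
      by (blast intro: walk_equiv_trans)
  qed (simp add: assms(3))
  then show ?thesis ..
qed

text \<open>The factors are replaced one after the other, each time with the other factor as a fixed
  context.\<close>

lemma walk_concat_cong:
  assumes G: "pair_pseudo_graph G"
    and \<alpha>: "\<alpha> \<in> walks G x y" and \<beta>: "\<beta> \<in> walks G y z"
    and \<alpha>': "(\<alpha>, \<alpha>') \<in> walk_equiv G" and \<beta>': "(\<beta>, \<beta>') \<in> walk_equiv G"
  shows "(walk_concat \<alpha> \<beta>, walk_concat \<alpha>' \<beta>') \<in> walk_equiv G"
proof -
  have w\<alpha>': "\<alpha>' \<in> walks G x y" and w\<beta>': "\<beta>' \<in> walks G y z"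
    using walk_equiv_in_walks[OF G] assms by blast+
  \<comment> \<open>The shared vertex \<open>y\<close> may be counted with either factor. By
    definition it belongs to the first one; here it is moved to the second, so that
    \<open>\<beta>\<close> appears as a whole and can be replaced.\<close>
  have eq: "walk_concat \<alpha>' \<gamma> = butlast \<alpha>' @ \<gamma>" if "\<gamma> \<in> walks G y z" for \<gamma>
    using w\<alpha>' that append_butlast_last_id[of \<alpha>']
    by (cases \<gamma>) (auto simp: walk_concat_def walks_iff[OF G] simp del: append_butlast_last_id)
  have "(walk_concat \<alpha> \<beta>, walk_concat \<alpha>' \<beta>) \<in> walk_equiv G"
    using walk_equiv_context[OF G \<alpha>', of "[]" "tl \<beta>"] walk_concat_in_walks[OF G \<alpha> \<beta>]
    by (auto simp: walk_concat_def)
  also have "(walk_concat \<alpha>' \<beta>, walk_concat \<alpha>' \<beta>') \<in> walk_equiv G"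
    using walk_equiv_context[OF G \<beta>', of "butlast \<alpha>'" "[]"] walk_concat_in_walks[OF G w\<alpha>' \<beta>]
    by (auto simp: eq \<beta> w\<beta>')
  finally show ?thesis .
qed

lemma walk_equiv_map:
  assumes G: "pair_pseudo_graph G" and H: "pair_pseudo_graph H" and f: "graph_hom G H f"
    and "(\<alpha>, \<beta>) \<in> walk_equiv G"
  shows "(map f \<alpha>, map f \<beta>) \<in> walk_equiv H"
proof -
  have "elementary_step H (map f a) (map f b)" if "elementary_step G a b" for a b
    using that
  proof cases
    case (spur xs c d ys v w)
    then show ?thesis
      using walk_map[OF G H f, of a v w]
        elementary_step.spur[of "map f xs" "f c" "f d" "map f ys" H "f v" "f w"] by simp
  next
    case (cross v w)
    moreover from this(3) have "cross_adjacent H (map f a) (map f b)"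
      using f by (auto simp: cross_adjacent_def graph_hom_def)
    ultimately show ?thesis
      using walk_map[OF G H f] elementary_step.cross by metis
  qed
  then have "equivclp (elementary_step H) (map f a) (map f b)" if "elementary_step G a b" for a b
    using that by (simp add: r_into_equivclp)
  from equivclp_map[where f = "map f", OF this] show ?thesis
    using assms(4) by (simp add: walk_equiv_iff[OF G] walk_equiv_iff[OF H])
qed

text \<open>At the turning point the walk has the form \<open>b, a, b\<close>. Removing this spur
  leaves the same kind of walk for \<open>\<alpha>\<close> without its last vertex, and induction
  from the right end contracts everything to \<open>x\<close>.\<close>

lemma walk_concat_rev:
  assumes G: "pair_pseudo_graph G" and "\<alpha> \<in> walks G x y"
  shows "(walk_concat \<alpha> (rev \<alpha>), [x]) \<in> walk_equiv G"
  using assms(2)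
proof (induction \<alpha> arbitrary: y rule: rev_induct)
  case (snoc a \<alpha>)
  show ?case
  proof (cases \<alpha> rule: rev_cases)
    case Nil
    then show ?thesis
      using snoc.prems by (simp add: walk_concat_def walks_iff[OF G])
  next
    case (snoc \<gamma> b)
    then have walk: "\<gamma> @ [b, a] \<in> walks G x y"
      using snoc.prems by simp
    then have \<alpha>: "\<alpha> \<in> walks G x b"
      using snoc by (auto simp: walks_iff[OF G] successively_append_iff hd_append)
    have "walk_concat (\<gamma> @ [b, a]) (rev (\<gamma> @ [b, a])) \<in> walks G x x"
      using walk_concat_in_walks[OF G walk walk_rev[OF G walk]] .
    then have "elementary_step G (\<gamma> @ [b, a, b] @ rev \<gamma>) (\<gamma> @ [b] @ rev \<gamma>)"
      by (intro elementary_step.spur) (simp add: walk_concat_def)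
    then have "(walk_concat (\<alpha> @ [a]) (rev (\<alpha> @ [a])), walk_concat \<alpha> (rev \<alpha>)) \<in> walk_equiv G"
      using elementary_step_imp_walk_equiv[OF G] snoc by (simp add: walk_concat_def)
    then show ?thesis
      using snoc.IH[OF \<alpha>] walk_equiv_trans by blast
  qed
qed (simp add: walks_iff[OF G])

section \<open>The fundamental groupoid as a category and its induced functors\<close>

lemma walk_concat_assoc:
  "\<beta> \<noteq> [] \<Longrightarrow> walk_concat (walk_concat \<alpha> \<beta>) \<gamma> = walk_concat \<alpha> (walk_concat \<beta> \<gamma>)"
  by (cases \<beta>) (auto simp: walk_concat_def)

abbreviation walk_class :: "'a pair_pre_digraph \<Rightarrow> 'a list \<Rightarrow> 'a list set" where
  "walk_class G \<alpha> \<equiv> walk_equiv G `` {\<alpha>}"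

lemma walk_class_eq: "(\<alpha>, \<beta>) \<in> walk_equiv G \<Longrightarrow> walk_class G \<alpha> = walk_class G \<beta>"
  using equiv_class_eq[OF equiv_walk_equiv] .

lemma Hom_fundamental_groupoid:
  "c \<in> Hom (fundamental_groupoid G) x y \<longleftrightarrow> (\<exists>\<alpha>\<in>walks G x y. c = walk_class G \<alpha>)"
  by (auto simp: fundamental_groupoid_def quotient_def)

text \<open>By \<open>walk_concat_cong\<close> all representatives contribute the same class to the
  union that defines \<open>Comp\<close>, and the index sets are nonempty, so the union is that
  class.\<close>

lemma Comp_walk_class:
  assumes G: "pair_pseudo_graph G" and \<alpha>: "\<alpha> \<in> walks G x y" and \<beta>: "\<beta> \<in> walks G y z"
  shows "Comp (fundamental_groupoid G) (walk_class G \<beta>) (walk_class G \<alpha>)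
    = walk_class G (walk_concat \<alpha> \<beta>)"
proof -
  have "walk_class G (walk_concat \<alpha>' \<beta>') = walk_class G (walk_concat \<alpha> \<beta>)"
    if "\<alpha>' \<in> walk_class G \<alpha>" "\<beta>' \<in> walk_class G \<beta>" for \<alpha>' \<beta>'
    using that walk_class_eq[OF walk_concat_cong[OF G \<alpha> \<beta>]] by simp
  moreover have "walk_class G \<alpha> \<noteq> {}" "walk_class G \<beta> \<noteq> {}"
    using walk_equiv_refl by fast+
  ultimately show ?thesis
    unfolding fundamental_groupoid_def precategory.simps by (intro SUP_eq_const)
qed

lemma arr_map_walk_class:
  assumes G: "pair_pseudo_graph G" and H: "pair_pseudo_graph H" and f: "graph_hom G H f"
  shows "arr_map (induced_functor H f) (walk_class G \<alpha>) = walk_class H (map f \<alpha>)"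
proof -
  have "walk_class H (map f \<alpha>') = walk_class H (map f \<alpha>)" if "\<alpha>' \<in> walk_class G \<alpha>" for \<alpha>'
    using that walk_equiv_map[OF G H f, of \<alpha> \<alpha>'] walk_class_eq[of "map f \<alpha>"] by auto
  moreover have "walk_class G \<alpha> \<noteq> {}"
    using walk_equiv_refl by fast
  ultimately show ?thesis
    unfolding induced_functor_def functor_data.simps by (intro SUP_eq_const)
qed

text \<open>The unit and associativity laws already hold as equalities of lists;
  \<open>Comp_walk_class\<close> carries them over to classes.\<close>

lemma category_fundamental_groupoid:
  assumes G: "pair_pseudo_graph G"
  shows "category (fundamental_groupoid G)"
proof -
  have Id: "Ident (fundamental_groupoid G) x = walk_class G [x]" for x
    by (simp add: fundamental_groupoid_def)
  have sing: "[x] \<in> walks G x x" if "x \<in> Obj (fundamental_groupoid G)" for x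
    using that by (simp add: fundamental_groupoid_def walk_singleton)
  have concat: "walk_concat [x] \<alpha> = \<alpha>" "walk_concat \<alpha> [y] = \<alpha>" if "\<alpha> \<in> walks G x y" for \<alpha> x y
    using that by (cases \<alpha>; auto simp: walks_iff[OF G] walk_concat_def)+
  show ?thesis
  proof
    fix x y z f g
    assume "f \<in> Hom (fundamental_groupoid G) x y" "g \<in> Hom (fundamental_groupoid G) y z"
    then show "Comp (fundamental_groupoid G) g f \<in> Hom (fundamental_groupoid G) x z"
      by (auto simp: Hom_fundamental_groupoid Comp_walk_class[OF G]
          intro!: bexI[OF _ walk_concat_in_walks[OF G]])
  next
    fix w x y z f g h
    assume "f \<in> Hom (fundamental_groupoid G) w x" "g \<in> Hom (fundamental_groupoid G) x y"
      "h \<in> Hom (fundamental_groupoid G) y z"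
    then obtain \<alpha> \<beta> \<gamma> where walks: "\<alpha> \<in> walks G w x" "\<beta> \<in> walks G x y" "\<gamma> \<in> walks G y z"
      and eqs: "f = walk_class G \<alpha>" "g = walk_class G \<beta>" "h = walk_class G \<gamma>"
      by (auto simp: Hom_fundamental_groupoid)
    have "\<beta> \<noteq> []"
      using walks by (simp add: walks_iff[OF G])
    then show "Comp (fundamental_groupoid G) h (Comp (fundamental_groupoid G) g f) =
        Comp (fundamental_groupoid G) (Comp (fundamental_groupoid G) h g) f"
      by (simp add: eqs walk_concat_assoc Comp_walk_class[OF G walks(1,2)]
          Comp_walk_class[OF G walks(2,3)]
          Comp_walk_class[OF G walk_concat_in_walks[OF G walks(1,2)] walks(3)]
          Comp_walk_class[OF G walks(1) walk_concat_in_walks[OF G walks(2,3)]])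
  next
    fix x y f
    assume x: "x \<in> Obj (fundamental_groupoid G)" and "f \<in> Hom (fundamental_groupoid G) x y"
    then obtain \<alpha> where \<alpha>: "\<alpha> \<in> walks G x y" "f = walk_class G \<alpha>"
      by (auto simp: Hom_fundamental_groupoid)
    then show "Comp (fundamental_groupoid G) f (Ident (fundamental_groupoid G) x) = f"
      by (simp add: Id Comp_walk_class[OF G sing[OF x] \<alpha>(1)] concat[OF \<alpha>(1)])
  next
    fix x y f
    assume y: "y \<in> Obj (fundamental_groupoid G)" and "f \<in> Hom (fundamental_groupoid G) x y"
    then obtain \<alpha> where \<alpha>: "\<alpha> \<in> walks G x y" "f = walk_class G \<alpha>"
      by (auto simp: Hom_fundamental_groupoid)
    then show "Comp (fundamental_groupoid G) (Ident (fundamental_groupoid G) y) f = f"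
      by (simp add: Id Comp_walk_class[OF G \<alpha>(1) sing[OF y]] concat[OF \<alpha>(1)])
  qed (auto simp: Id Hom_fundamental_groupoid intro: sing)
qed

lemma cat_functor_induced_functor:
  assumes G: "pair_pseudo_graph G" and H: "pair_pseudo_graph H" and f: "graph_hom G H f"
  shows "cat_functor (fundamental_groupoid G) (fundamental_groupoid H) (induced_functor H f)"
proof -
  interpret C: category "fundamental_groupoid G"
    using category_fundamental_groupoid[OF G] .
  interpret D: category "fundamental_groupoid H"
    using category_fundamental_groupoid[OF H] .
  have obj: "obj_map (induced_functor H f) = f"
    by (simp add: induced_functor_def)
  show ?thesis
  proof
    fix x assume "x \<in> Obj (fundamental_groupoid G)"
    then show "obj_map (induced_functor H f) x \<in> Obj (fundamental_groupoid H)"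
      using f by (simp add: obj fundamental_groupoid_def graph_hom_def)
    have "arr_map (induced_functor H f) (walk_class G [x]) = walk_class H [f x]"
      using arr_map_walk_class[OF G H f, of "[x]"] by simp
    then show "arr_map (induced_functor H f) (Ident (fundamental_groupoid G) x) =
        Ident (fundamental_groupoid H) (obj_map (induced_functor H f) x)"
      unfolding obj by (simp add: fundamental_groupoid_def)
  next
    fix x y c assume "c \<in> Hom (fundamental_groupoid G) x y"
    then show "arr_map (induced_functor H f) c \<in> Hom (fundamental_groupoid H)
        (obj_map (induced_functor H f) x) (obj_map (induced_functor H f) y)"
      using walk_map[OF G H f]
      by (auto simp: obj Hom_fundamental_groupoid arr_map_walk_class[OF G H f])
  next
    fix x y z c d
    assume "c \<in> Hom (fundamental_groupoid G) x y" "d \<in> Hom (fundamental_groupoid G) y z"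
    then obtain \<alpha> \<beta> where walks: "\<alpha> \<in> walks G x y" "\<beta> \<in> walks G y z"
      and eqs: "c = walk_class G \<alpha>" "d = walk_class G \<beta>"
      by (auto simp: Hom_fundamental_groupoid)
    have "map f (walk_concat \<alpha> \<beta>) = walk_concat (map f \<alpha>) (map f \<beta>)"
      by (simp add: walk_concat_def map_tl)
    then show "arr_map (induced_functor H f) (Comp (fundamental_groupoid G) d c) =
        Comp (fundamental_groupoid H) (arr_map (induced_functor H f) d)
          (arr_map (induced_functor H f) c)"
      by (simp add: eqs Comp_walk_class[OF G walks] arr_map_walk_class[OF G H f]
          Comp_walk_class[OF H walk_map[OF G H f walks(1)] walk_map[OF G H f walks(2)]])
  qed
qed

section \<open>Families of walks that are natural along edges\<close>

text \<open>It suffices to test naturality on edges, since these generate the fundamental groupoid.\<close>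

definition natural_walks ::
  "'a pair_pre_digraph \<Rightarrow> 'b pair_pre_digraph \<Rightarrow> ('a \<Rightarrow> 'b) \<Rightarrow> ('a \<Rightarrow> 'b) \<Rightarrow> ('a \<Rightarrow> 'b list) \<Rightarrow> bool"
  where
  "natural_walks G H f g N \<longleftrightarrow>
     (\<forall>v \<in> pverts G. N v \<in> walks H (f v) (g v)) \<and>
     (\<forall>v w. (v, w) \<in> parcs G \<longrightarrow>
        (walk_concat (N v) [g v, g w], walk_concat [f v, f w] (N w)) \<in> walk_equiv H)"

text \<open>The end levels of a \<times>-homotopy agree with the given morphisms only on
  \<open>pverts G\<close>, so they cannot be substituted as functions.\<close>

lemma natural_walks_cong:
  assumes G: "pair_pseudo_graph G" and "natural_walks G H f g N"
    and "\<And>v. v \<in> pverts G \<Longrightarrow> f v = f' v" "\<And>v. v \<in> pverts G \<Longrightarrow> g v = g' v"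
  shows "natural_walks G H f' g' N"
  unfolding natural_walks_def
proof (intro conjI ballI allI impI)
  fix v w assume vw: "(v, w) \<in> parcs G"
  show "(walk_concat (N v) [g' v, g' w], walk_concat [f' v, f' w] (N w)) \<in> walk_equiv H"
    using assms(2) vw parcs_in_pverts[OF G vw] by (simp add: natural_walks_def flip: assms(3,4))
qed (use assms(2-) in \<open>auto simp: natural_walks_def\<close>)

lemma natural_walks_refl:
  assumes "graph_hom G H f"
  shows "natural_walks G H f f (\<lambda>v. [f v])"
  using assms by (auto simp: natural_walks_def graph_hom_def walk_singleton walk_concat_def)

text \<open>Two naturality squares over the edge from \<open>v\<close> to \<open>w\<close> are
  pasted along their common side \<open>[g v, g w]\<close>: first the edge is moved past
  \<open>M\<close>, then past \<open>N\<close>.\<close>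

lemma natural_walks_trans:
  assumes G: "pair_pseudo_graph G" and H: "pair_pseudo_graph H"
    and f: "graph_hom G H f" and g: "graph_hom G H g" and h: "graph_hom G H h"
    and N: "natural_walks G H f g N" and M: "natural_walks G H g h M"
  shows "natural_walks G H f h (\<lambda>v. walk_concat (N v) (M v))"
  unfolding natural_walks_def
proof (intro conjI ballI allI impI)
  fix v assume "v \<in> pverts G"
  then show "walk_concat (N v) (M v) \<in> walks H (f v) (h v)"
    using N M walk_concat_in_walks[OF H] by (auto simp: natural_walks_def)
next
  fix v w assume vw: "(v, w) \<in> parcs G"
  have v: "v \<in> pverts G" and w: "w \<in> pverts G"
    using parcs_in_pverts[OF G vw] .
  have Nv: "N v \<in> walks H (f v) (g v)" and Nw: "N w \<in> walks H (f w) (g w)"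
    and Mv: "M v \<in> walks H (g v) (h v)" and Mw: "M w \<in> walks H (g w) (h w)"
    using N M v w by (auto simp: natural_walks_def)
  have fw: "[f v, f w] \<in> walks H (f v) (f w)" and gw: "[g v, g w] \<in> walks H (g v) (g w)"
    and hw: "[h v, h w] \<in> walks H (h v) (h w)"
    using f g h vw walk_edge[OF H] by (auto simp: graph_hom_def)
  have ne: "M v \<noteq> []" "N w \<noteq> []"
    using Mv Nw by (auto simp: walks_iff[OF H])
  have "(walk_concat (N v) (walk_concat (M v) [h v, h w]),
      walk_concat (N v) (walk_concat [g v, g w] (M w))) \<in> walk_equiv H"
    using M vw by (intro walk_concat_cong[OF H Nv walk_concat_in_walks[OF H Mv hw]])
      (auto simp: natural_walks_def)
  also have "walk_concat (N v) (walk_concat [g v, g w] (M w)) =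
      walk_concat (walk_concat (N v) [g v, g w]) (M w)"
    by (simp add: walk_concat_assoc)
  also have "(\<dots>, walk_concat (walk_concat [f v, f w] (N w)) (M w)) \<in> walk_equiv H"
    using N vw by (intro walk_concat_cong[OF H walk_concat_in_walks[OF H Nv gw] Mw])
      (auto simp: natural_walks_def)
  finally show "(walk_concat (walk_concat (N v) (M v)) [h v, h w],
      walk_concat [f v, f w] (walk_concat (N w) (M w))) \<in> walk_equiv H"
    using ne by (simp add: walk_concat_assoc)
qed

lemma cross_adjacent_Cons:
  "cross_adjacent G (a # b # \<alpha>) (a' # b' # \<beta>) \<longleftrightarrow>
    (a, b') \<in> parcs G \<and> (a', b) \<in> parcs G \<and> cross_adjacent G (b # \<alpha>) (b' # \<beta>)"
  unfolding cross_adjacent_def by (auto simp: All_less_Suc2)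

lemma ex_natural_walks_one_step:
  assumes G: "pair_pseudo_graph G" and H: "pair_pseudo_graph H"
    and f: "graph_hom G H f" and g: "graph_hom G H g"
    and fg: "\<And>v w. (v, w) \<in> parcs G \<Longrightarrow> (f v, g w) \<in> parcs H"
    and iso: "\<nexists>v. isolated_vertex G v"
  shows "\<exists>N. natural_walks G H f g N"
proof -
  \<comment> \<open>The absence of isolated vertices in \<open>G\<close> supplies a neighbour
    \<open>u v\<close>. It is needed since \<open>f v\<close> and \<open>g v\<close> need not be
    adjacent, whereas both are adjacent to \<open>f (u v)\<close>.\<close>
  obtain u where u: "(v, u v) \<in> parcs G" if "v \<in> pverts G" for v
    using iso unfolding isolated_vertex_def by metis
  have f': "(f v, f w) \<in> parcs H" and g': "(g v, g w) \<in> parcs H"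
    if "(v, w) \<in> parcs G" for v w
    using f g that by (auto simp: graph_hom_def)
  note arcs = fg f' g'
  define N where "N v = [f v, f (u v), g v]" for v
  have sym: "(w, v) \<in> parcs G" if "(v, w) \<in> parcs G" for v w
    using parcs_sym[OF G that] .
  have "natural_walks G H f g N"
    unfolding natural_walks_def
  proof (intro conjI ballI allI impI)
    fix v assume "v \<in> pverts G"
    then have "(v, u v) \<in> parcs G" "(u v, v) \<in> parcs G"
      using u sym by auto
    then show "N v \<in> walks H (f v) (g v)"
      using arcs by (auto simp: N_def walks_iff[OF H] dest: parcs_in_pverts[OF H])
  next
    fix v w assume vw: "(v, w) \<in> parcs G"
    have G': "(v, u v) \<in> parcs G" "(w, u w) \<in> parcs G" "(u v, v) \<in> parcs G" "(u w, w) \<in> parcs G"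
      "(w, v) \<in> parcs G"
      using u sym parcs_in_pverts[OF G vw] vw by auto
    have arcsH: "(f v, f (u v)) \<in> parcs H" "(f (u v), g v) \<in> parcs H" "(g v, g w) \<in> parcs H"
      "(f v, f w) \<in> parcs H" "(f w, f v) \<in> parcs H" "(f v, g w) \<in> parcs H"
      "(f w, f (u w)) \<in> parcs H" "(f (u w), g w) \<in> parcs H"
      "(f (u v), f v) \<in> parcs H" "(f w, g v) \<in> parcs H"
      using arcs G' vw by auto
    \<comment> \<open>The outer walks are the two sides of the naturality square. The middle one is
      free of \<open>u\<close>: passing from \<open>?\<alpha>\<close> to \<open>?\<beta>\<close>
      changes both inner vertices at once, using \<open>f w\<close> adjacent to \<open>g v\<close>;
      passing on to \<open>?\<gamma>\<close> changes only the third entry.\<close>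
    let ?\<alpha> = "[f v, f (u v), g v, g w]" and ?\<beta> = "[f v, f w, f v, g w]"
      and ?\<gamma> = "[f v, f w, f (u w), g w]"
    have "?\<alpha> \<in> walks H (f v) (g w)" "?\<beta> \<in> walks H (f v) (g w)" "?\<gamma> \<in> walks H (f v) (g w)"
      using arcsH parcs_in_pverts[OF H] by (auto simp: walks_iff[OF H])
    moreover have "cross_adjacent H ?\<alpha> ?\<beta>" "cross_adjacent H ?\<beta> ?\<gamma>"
      using arcsH by (auto simp: cross_adjacent_Cons) (auto simp: cross_adjacent_def)
    ultimately have "(?\<alpha>, ?\<gamma>) \<in> walk_equiv H"
      using elementary_step.cross elementary_step_imp_walk_equiv[OF H] walk_equiv_trans by metis
    then show "(walk_concat (N v) [g v, g w], walk_concat [f v, f w] (N w)) \<in> walk_equiv H"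
      by (simp add: N_def walk_concat_def)
  qed
  then show ?thesis
    by blast
qed

lemma ex_natural_walks:
  assumes G: "pair_pseudo_graph G" and H: "pair_pseudo_graph H"
    and iso: "\<nexists>v. isolated_vertex G v" and "times_homotopic G H f g"
  shows "\<exists>N. natural_walks G H f g N"
proof -
  obtain n \<Lambda> where \<Lambda>: "graph_hom (graph_prod G (looped_path_graph n)) H \<Lambda>"
    and ends: "\<And>v. v \<in> pverts G \<Longrightarrow> \<Lambda> (v, 0) = f v" "\<And>v. v \<in> pverts G \<Longrightarrow> \<Lambda> (v, n) = g v"
    using assms(4) unfolding times_homotopic_def by blast
  \<comment> \<open>Equal levels \<open>j = k\<close> show that each level is a morphism;
    \<open>k = Suc j\<close> is the adjacency hypothesis of
    \<open>ex_natural_walks_one_step\<close>.\<close>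
  have arc: "(\<Lambda> (v, j), \<Lambda> (w, k)) \<in> parcs H"
    if "(v, w) \<in> parcs G" "j \<le> n" "k \<le> n" "j = k \<or> k = Suc j" for v w j k
    using \<Lambda> that by (auto simp: graph_hom_def graph_prod_def looped_path_graph_def)
  have hom: "graph_hom G H (\<lambda>v. \<Lambda> (v, j))" if "j \<le> n" for j
    using \<Lambda> arc that by (auto simp: graph_hom_def graph_prod_def looped_path_graph_def)
  have "\<exists>N. natural_walks G H (\<lambda>v. \<Lambda> (v, 0)) (\<lambda>v. \<Lambda> (v, k)) N" if "k \<le> n" for k
    using that
  proof (induction k)
    case 0
    then show ?case
      using natural_walks_refl[OF hom] by blast
  next
    case (Suc k)
    then obtain N where N: "natural_walks G H (\<lambda>v. \<Lambda> (v, 0)) (\<lambda>v. \<Lambda> (v, k)) N"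
      by auto
    obtain M where M: "natural_walks G H (\<lambda>v. \<Lambda> (v, k)) (\<lambda>v. \<Lambda> (v, Suc k)) M"
      using ex_natural_walks_one_step[OF G H hom hom _ iso, of k "Suc k"] arc Suc.prems by auto
    show ?case
      using natural_walks_trans[OF G H hom hom hom N M] Suc.prems by auto
  qed
  then obtain N where "natural_walks G H (\<lambda>v. \<Lambda> (v, 0)) (\<lambda>v. \<Lambda> (v, n)) N"
    by blast
  then show ?thesis
    using natural_walks_cong[OF G] ends by blast
qed

text \<open>The first edge of \<open>\<alpha>\<close> is moved past the component by naturality on
  edges, and the induction hypothesis moves the remaining walk past the component at
  \<open>b\<close>. A walk of length zero leaves \<open>N v\<close> on both sides.\<close>

lemma natural_walks_walk:
  assumes G: "pair_pseudo_graph G" and H: "pair_pseudo_graph H"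
    and f: "graph_hom G H f" and g: "graph_hom G H g"
    and N: "natural_walks G H f g N" and "\<alpha> \<in> walks G v w"
  shows "(walk_concat (N v) (map g \<alpha>), walk_concat (map f \<alpha>) (N w)) \<in> walk_equiv H"
  using assms(6)
proof (induction \<alpha> arbitrary: v rule: induct_list012)
  case 1
  then show ?case by (simp add: walks_iff[OF G])
next
  case (2 a)
  then have "N v \<in> walks H (f v) (g v)" "v = a" "w = a"
    using N by (auto simp: natural_walks_def walks_iff[OF G])
  then show ?case
    by (cases "N a") (auto simp: walk_concat_def walks_iff[OF H])
next
  case (3 a b \<alpha>)
  have va: "v = a" and ab: "(a, b) \<in> parcs G" and b: "b # \<alpha> \<in> walks G b w"
    and ends: "a \<in> pverts G" "b \<in> pverts G" "w \<in> pverts G"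
    using 3(3) by (auto simp: walks_iff[OF G] split: if_splits)
  have Na: "N a \<in> walks H (f a) (g a)" and Nb: "N b \<in> walks H (f b) (g b)"
    and Nw: "N w \<in> walks H (f w) (g w)"
    using N ends by (auto simp: natural_walks_def)
  have edge: "[f a, f b] \<in> walks H (f a) (f b)" "[g a, g b] \<in> walks H (g a) (g b)"
    using f g ab walk_edge[OF H] by (auto simp: graph_hom_def)
  have maps: "map f (b # \<alpha>) \<in> walks H (f b) (f w)" "map g (b # \<alpha>) \<in> walks H (g b) (g w)"
    using walk_map[OF G H _ b] f g by auto
  have split: "map h (a # b # \<alpha>) = walk_concat [h a, h b] (map h (b # \<alpha>))" for h :: "'a \<Rightarrow> 'b"
    by (simp add: walk_concat_def)
  have ne: "N b \<noteq> []"
    using Nb by (auto simp: walks_iff[OF H])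
  have "walk_concat (N a) (map g (a # b # \<alpha>)) =
      walk_concat (walk_concat (N a) [g a, g b]) (map g (b # \<alpha>))"
    unfolding split by (simp add: walk_concat_assoc)
  also have "(\<dots>, walk_concat (walk_concat [f a, f b] (N b)) (map g (b # \<alpha>))) \<in> walk_equiv H"
    using N ab by (intro walk_concat_cong[OF H walk_concat_in_walks[OF H Na edge(2)] maps(2)])
      (auto simp: natural_walks_def)
  also have "walk_concat (walk_concat [f a, f b] (N b)) (map g (b # \<alpha>)) =
      walk_concat [f a, f b] (walk_concat (N b) (map g (b # \<alpha>)))"
    using ne by (rule walk_concat_assoc)
  also have "(\<dots>, walk_concat [f a, f b] (walk_concat (map f (b # \<alpha>)) (N w))) \<in> walk_equiv H"
    by (intro walk_concat_cong[OF H edge(1) walk_concat_in_walks[OF H Nb maps(2)]] 3(2)[OF b])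
      simp
  also have "walk_concat [f a, f b] (walk_concat (map f (b # \<alpha>)) (N w)) =
      walk_concat (map f (a # b # \<alpha>)) (N w)"
    unfolding split by (simp add: walk_concat_assoc)
  finally show ?case
    unfolding va .
qed

section \<open>Inverses and the natural isomorphism\<close>

text \<open>The class of the reversed walk is the inverse. Both identities come from
  \<open>walk_concat_rev\<close>, applied once to \<open>\<alpha>\<close> and once to
  \<open>rev \<alpha>\<close>, whose reverse is \<open>\<alpha>\<close>.\<close>

lemma iso_arrow_walk_class:
  assumes G: "pair_pseudo_graph G" and \<alpha>: "\<alpha> \<in> walks G x y"
  shows "iso_arrow (fundamental_groupoid G) x y (walk_class G \<alpha>)"
proof -
  have rev: "rev \<alpha> \<in> walks G y x"
    using walk_rev[OF G \<alpha>] .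
  have "Comp (fundamental_groupoid G) (walk_class G (rev \<alpha>)) (walk_class G \<alpha>) =
      Ident (fundamental_groupoid G) x"
    unfolding Comp_walk_class[OF G \<alpha> rev] walk_class_eq[OF walk_concat_rev[OF G \<alpha>]]
    by (simp add: fundamental_groupoid_def)
  moreover have "Comp (fundamental_groupoid G) (walk_class G \<alpha>) (walk_class G (rev \<alpha>)) =
      Ident (fundamental_groupoid G) y"
    unfolding Comp_walk_class[OF G rev \<alpha>]
      walk_class_eq[OF walk_concat_rev[OF G rev, unfolded rev_rev_ident]]
    by (simp add: fundamental_groupoid_def)
  moreover have "walk_class G \<alpha> \<in> Hom (fundamental_groupoid G) x y"
    "walk_class G (rev \<alpha>) \<in> Hom (fundamental_groupoid G) y x"
    using \<alpha> rev by (auto simp: Hom_fundamental_groupoid)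
  ultimately show ?thesis
    unfolding iso_arrow_def by blast
qed

theorem theorem4p7:
  fixes G :: "'a pair_pre_digraph" and H :: "'b pair_pre_digraph"
    and \<phi> \<psi> :: "'a \<Rightarrow> 'b"
  assumes "pair_pseudo_graph G" and "pair_pseudo_graph H"
    and "\<nexists>v. isolated_vertex G v" and "\<nexists>v. isolated_vertex H v"
    and "graph_hom G H \<phi>" and "graph_hom G H \<psi>"
    and "times_homotopic G H \<phi> \<psi>"
  shows "\<exists>\<eta>. natural_isomorphism (fundamental_groupoid G) (fundamental_groupoid H)
               (induced_functor H \<phi>) (induced_functor H \<psi>) \<eta>"
proof -
  note G = assms(1) and H = assms(2) and \<phi> = assms(5) and \<psi> = assms(6)
  obtain N where N: "natural_walks G H \<phi> \<psi> N"
    using ex_natural_walks[OF G H assms(3,7)] by blast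
  have N_walk: "N x \<in> walks H (\<phi> x) (\<psi> x)" if "x \<in> Obj (fundamental_groupoid G)" for x
    using N that by (simp add: natural_walks_def fundamental_groupoid_def)
  have obj: "obj_map (induced_functor H f) = f" for f :: "'a \<Rightarrow> 'b"
    by (simp add: induced_functor_def)
  interpret F: cat_functor "fundamental_groupoid G" "fundamental_groupoid H" "induced_functor H \<phi>"
    using cat_functor_induced_functor[OF G H \<phi>] .
  interpret F': cat_functor "fundamental_groupoid G" "fundamental_groupoid H" "induced_functor H \<psi>"
    using cat_functor_induced_functor[OF G H \<psi>] .
  have "natural_isomorphism (fundamental_groupoid G) (fundamental_groupoid H)
      (induced_functor H \<phi>) (induced_functor H \<psi>) (\<lambda>x. walk_class H (N x))"
  proof
    fix x assume "x \<in> Obj (fundamental_groupoid G)"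
    then show "walk_class H (N x) \<in> Hom (fundamental_groupoid H)
        (obj_map (induced_functor H \<phi>) x) (obj_map (induced_functor H \<psi>) x)"
      and "iso_arrow (fundamental_groupoid H) (obj_map (induced_functor H \<phi>) x)
        (obj_map (induced_functor H \<psi>) x) (walk_class H (N x))"
      using N_walk iso_arrow_walk_class[OF H] by (auto simp: obj Hom_fundamental_groupoid)
  next
    fix x y c
    assume xy: "x \<in> Obj (fundamental_groupoid G)" "y \<in> Obj (fundamental_groupoid G)"
      and "c \<in> Hom (fundamental_groupoid G) x y"
    then obtain \<alpha> where \<alpha>: "\<alpha> \<in> walks G x y" and c: "c = walk_class G \<alpha>"
      by (auto simp: Hom_fundamental_groupoid)
    show "Comp (fundamental_groupoid H) (arr_map (induced_functor H \<psi>) c) (walk_class H (N x)) =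
        Comp (fundamental_groupoid H) (walk_class H (N y)) (arr_map (induced_functor H \<phi>) c)"
      \<comment> \<open>For a representative \<open>\<alpha>\<close> of the arrow, both composites
        are classes of concatenations, and \<open>natural_walks_walk\<close> says that these two
        walks are equivalent.\<close>
      using walk_class_eq[OF natural_walks_walk[OF G H \<phi> \<psi> N \<alpha>]]
      by (simp add: c arr_map_walk_class[OF G H] \<phi> \<psi>
          Comp_walk_class[OF H N_walk[OF xy(1)] walk_map[OF G H \<psi> \<alpha>]]
          Comp_walk_class[OF H walk_map[OF G H \<phi> \<alpha>] N_walk[OF xy(2)]])
  qed
  then show ?thesis
    by blast
qed

end
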